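(* Let $\theta\in\{\cup,\triangleright,\otimes\}$, and let $\succ$ and $\succ_0$ be preference relations over a relation schema $R$. For an instance $r$ of $R$ put \[\succ_1\,=\,TC(\succ_0\,\theta\,\succ),\quad \succ_2\,=\,[TC(\succ_0\,\theta\,\succ)]_r,\quad \succ_3\,=\,TC([\succ_0\,\theta\,\succ]_r).\] Then for every instance $r$ of $R$: if $\succ_1$ is a strict partial order (SPO), then $\succ_2$ is an SPO; and if $\succ_2$ is an SPO, then $\succ_3$ is an SPO. Moreover, for each of these two implications there are cases (choices of $\succ$, $\succ_0$, $r$) in which the reverse implication does not hold.
   Context: A relation schema $R$ determines a set $U$ of all possible tuples (a product of attribute domains, each a countably infinite set of constants or $\mathbb{Q}$). An instance of $R$ is a finite set of tuples from $U$. A preference relation over $R$ is any subset of $U\times U$ (possibly infinite). An SPO is an irreflexive and transitive preference relation. The restriction of $\succ$ to $r$ is the preference relation $[\succ]_r\,=\,\succ\cap\,(r\times r)$. $TC(\cdot)$ denotes transitive closure (chains of length $\ge 1$). Composition operators: union $\succ_1\cup\succ_2$ is set union; prioritized composition: $t_1(\succ_1\triangleright\succ_2)t_2$ iff $t_1\succ_1 t_2\vee(t_2\not\succ_1 t_1\wedge t_1\succ_2 t_2)$; Pareto composition: $t_1(\succ_1\otimes\succ_2)t_2$ iff $(t_1\succ_1 t_2\wedge t_2\not\succ_2 t_1)\vee(t_1\succ_2 t_2\wedge t_2\not\succ_1 t_1)$ (here $\succ_1,\succ_2$ are generic names for the arguments of the operators). *)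

theory Defs
  imports "HOL-Library.Countable_Set"
begin

text \<open>
  Values are uninterpreted constants (\<^term>\<open>Inl c\<close>) or rational numbers (\<^term>\<open>Inr q\<close>).
  A schema is the nonempty list of its attribute domains; attribute names play no role.
  The product of the domains is the library's \<^const>\<open>listset\<close>, so tuples are lists of values.
\<close>

type_synonym 'c schema = "('c + rat) set list"
type_synonym 'c tuple = "('c + rat) list"

definition attribute_domain :: "('c + rat) set \<Rightarrow> bool" where
  "attribute_domain D \<longleftrightarrow>
     (\<exists>C. countable C \<and> infinite C \<and> D = Inl ` C) \<or> D = range Inr"

definition relation_schema :: "'c schema \<Rightarrow> bool" where
  "relation_schema R \<longleftrightarrow> R \<noteq> [] \<and> (\<forall>D \<in> set R. attribute_domain D)"

definition tuples :: "'c schema \<Rightarrow> 'c tuple set" where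
  "tuples R = listset R"

definition is_instance :: "'c schema \<Rightarrow> 'c tuple set \<Rightarrow> bool" where
  "is_instance R r \<longleftrightarrow> finite r \<and> r \<subseteq> tuples R"

definition preference_relation :: "'c schema \<Rightarrow> 'c tuple rel \<Rightarrow> bool" where
  "preference_relation R p \<longleftrightarrow> p \<subseteq> tuples R \<times> tuples R"

definition SPO :: "'c schema \<Rightarrow> 'c tuple rel \<Rightarrow> bool" where
  "SPO R p \<longleftrightarrow> preference_relation R p \<and> irrefl p \<and> trans p"

definition restriction :: "'a rel \<Rightarrow> 'a set \<Rightarrow> 'a rel" where
  "restriction p r = p \<inter> (r \<times> r)"

definition prioritized :: "'a rel \<Rightarrow> 'a rel \<Rightarrow> 'a rel" where
  "prioritized p q = {(s, t). (s, t) \<in> p \<or> ((t, s) \<notin> p \<and> (s, t) \<in> q)}"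

definition pareto :: "'a rel \<Rightarrow> 'a rel \<Rightarrow> 'a rel" where
  "pareto p q =
     {(s, t). ((s, t) \<in> p \<and> (t, s) \<notin> q) \<or> ((s, t) \<in> q \<and> (t, s) \<notin> p)}"

end

theory Submission
  imports Defs
begin

text \<open>
  The implications hold because irreflexivity and containment in a product set are inherited by
  subrelations, and the transitive closure of the restriction is contained in the restriction of
  the transitive closure. Since the empty relation is a left unit of all three operators, both
  converses are refuted by one relation, a two-cycle on distinct tuples \<open>a\<close> and \<open>b\<close>: its transitive
  closure has the loop at \<open>a\<close>, which the empty instance does not see, and which the instance
  containing only \<open>a\<close> sees only if the closure is taken before restricting.
\<close>

lemma infinite_attribute_domain: "attribute_domain D \<Longrightarrow> infinite D"
  unfolding attribute_domain_def
  by (auto dest!: finite_imageD simp: infinite_UNIV_char_0)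

lemma listset_eq_empty_iff: "listset As = {} \<longleftrightarrow> {} \<in> set As"
  by (induction As) (auto simp: set_Cons_def)

text \<open>Supplies the vertices of the two-cycle. The first domain is infinite, so two values
  \<open>x\<close> and \<open>y\<close> can be put in front of one common tail
  \<open>xs\<close>.\<close>

lemma relation_schema_two_tuples:
  assumes "relation_schema R"
  obtains a b where "a \<in> tuples R" "b \<in> tuples R" "a \<noteq> b"
proof -
  obtain D Ds where R: "R = D # Ds"
    using assms by (cases R) (auto simp: relation_schema_def)
  have inf: "infinite A" if "A \<in> set R" for A
    using assms that infinite_attribute_domain by (auto simp: relation_schema_def)
  \<comment> \<open>A tail exists because no remaining domain is empty; if \<open>Ds\<close> is
    \<open>[]\<close>, the tail is \<open>[]\<close>.\<close>
  have "{} \<notin> set Ds"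
    using inf R by fastforce
  then obtain xs where xs: "xs \<in> listset Ds"
    by (metis ex_in_conv listset_eq_empty_iff)
  have "infinite D"
    using inf R by simp
  then obtain x where x: "x \<in> D"
    by (metis finite.emptyI ex_in_conv)
  from \<open>infinite D\<close> have "infinite (D - {x})"
    by simp
  then obtain y where y: "y \<in> D" "y \<noteq> x"
    by (metis finite.emptyI ex_in_conv Diff_iff singletonI)
  show thesis
    by (rule that[of "x # xs" "y # xs"]) (use x y xs R in \<open>auto simp: tuples_def set_Cons_def\<close>)
qed

text \<open>A chain with all steps inside \<open>r\<close> is a chain of \<open>p\<close> with both
  ends in \<open>r\<close>. Equality can fail, since a chain of \<open>p\<close> between points of
  \<open>r\<close> may pass outside \<open>r\<close>.\<close>

lemma trancl_restriction_subset: "(restriction p r)\<^sup>+ \<subseteq> restriction (p\<^sup>+) r"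
proof -
  have "(restriction p r)\<^sup>+ \<subseteq> p\<^sup>+"
    by (rule trancl_mono_subset) (simp add: restriction_def)
  moreover have "(restriction p r)\<^sup>+ \<subseteq> r \<times> r"
    by (rule trancl_subset_Sigma) (simp add: restriction_def)
  ultimately show ?thesis
    by (simp add: restriction_def)
qed

text \<open>Transitivity is assumed of \<open>p\<close> itself because it does not pass to
  subrelations.\<close>

lemma SPO_subset: "SPO R q \<Longrightarrow> p \<subseteq> q \<Longrightarrow> trans p \<Longrightarrow> SPO R p"
  by (auto simp: SPO_def preference_relation_def irrefl_def)

lemma SPO_restriction: "SPO R p \<Longrightarrow> SPO R (restriction p r)"
  by (frule SPO_subset[where p = "restriction p r"]) (auto simp: restriction_def SPO_def intro!: transI dest: transD)

lemma SPO_empty: "SPO R {}"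
  by (simp add: SPO_def preference_relation_def irrefl_def)

lemma not_SPO_loop: "(a, a) \<in> p \<Longrightarrow> \<not> SPO R p"
  by (auto simp: SPO_def irrefl_def)

text \<open>An empty first argument adds no pairs and blocks none of \<open>p\<close>. This lets one
  counterexample serve all three operators.\<close>

lemma composition_empty_left:
  assumes "\<theta> \<in> {(\<union>), prioritized, pareto}"
  shows "\<theta> {} p = p"
  using assms by (auto simp: prioritized_def pareto_def)

theorem theorem12:
  fixes R :: "'c schema"
    and \<theta> :: "'c tuple rel \<Rightarrow> 'c tuple rel \<Rightarrow> 'c tuple rel"
  assumes "relation_schema R"
    and "\<theta> \<in> {(\<union>), prioritized, pareto}"
  shows
    "(\<forall>p p0 r. preference_relation R p \<and> preference_relation R p0 \<and> is_instance R r \<longrightarrow>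
        (SPO R (trancl (\<theta> p0 p)) \<longrightarrow> SPO R (restriction (trancl (\<theta> p0 p)) r)) \<and>
        (SPO R (restriction (trancl (\<theta> p0 p)) r) \<longrightarrow> SPO R (trancl (restriction (\<theta> p0 p) r)))) \<and>
     (\<exists>p p0 r. preference_relation R p \<and> preference_relation R p0 \<and> is_instance R r \<and>
        SPO R (restriction (trancl (\<theta> p0 p)) r) \<and> \<not> SPO R (trancl (\<theta> p0 p))) \<and>
     (\<exists>p p0 r. preference_relation R p \<and> preference_relation R p0 \<and> is_instance R r \<and>
        SPO R (trancl (restriction (\<theta> p0 p) r)) \<and> \<not> SPO R (restriction (trancl (\<theta> p0 p)) r))"
proof (intro conjI)
  show "\<forall>p p0 r. preference_relation R p \<and> preference_relation R p0 \<and> is_instance R r \<longrightarrow>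
        (SPO R (trancl (\<theta> p0 p)) \<longrightarrow> SPO R (restriction (trancl (\<theta> p0 p)) r)) \<and>
        (SPO R (restriction (trancl (\<theta> p0 p)) r) \<longrightarrow> SPO R (trancl (restriction (\<theta> p0 p) r)))"
    by (meson SPO_restriction SPO_subset trancl_restriction_subset trans_trancl)
next
  obtain a b where ab: "a \<in> tuples R" "b \<in> tuples R" "a \<noteq> b"
    using relation_schema_two_tuples[OF assms(1)] .
  define c where "c = {(a, b), (b, a)}"
  have c: "preference_relation R c" "preference_relation R {}"
    using ab by (simp_all add: c_def preference_relation_def)
  have "(a, b) \<in> c" "(b, a) \<in> c"
    by (simp_all add: c_def)
  then have loop: "(a, a) \<in> c\<^sup>+"
    by (meson r_into_trancl' trancl_into_trancl)
  have unit: "\<theta> {} c = c"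
    using assms(2) by (rule composition_empty_left)

  have "restriction (c\<^sup>+) {} = {}"
    by (simp add: restriction_def)
  then have "SPO R (restriction ((\<theta> {} c)\<^sup>+) {})" "\<not> SPO R ((\<theta> {} c)\<^sup>+)"
    using SPO_empty not_SPO_loop[OF loop] by (simp_all add: unit)
  moreover have "is_instance R {}"
    by (simp add: is_instance_def)
  ultimately show "\<exists>p p0 r. preference_relation R p \<and> preference_relation R p0 \<and> is_instance R r \<and>
        SPO R (restriction (trancl (\<theta> p0 p)) r) \<and> \<not> SPO R (trancl (\<theta> p0 p))"
    using c by blast

  \<comment> \<open>As \<open>a\<close> and \<open>b\<close> differ, \<open>c\<close> itself has no
    loop at \<open>a\<close>; the loop in its closure comes from the detour through
    \<open>b\<close>, outside the instance.\<close>
  have "restriction c {a} = {}" "(a, a) \<in> restriction (c\<^sup>+) {a}"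
    using ab(3) loop by (auto simp: c_def restriction_def)
  then have "SPO R ((restriction (\<theta> {} c) {a})\<^sup>+)" "\<not> SPO R (restriction ((\<theta> {} c)\<^sup>+) {a})"
    using SPO_empty not_SPO_loop by (simp_all add: unit)
  moreover have "is_instance R {a}"
    using ab(1) by (simp add: is_instance_def)
  ultimately show "\<exists>p p0 r. preference_relation R p \<and> preference_relation R p0 \<and> is_instance R r \<and>
        SPO R (trancl (restriction (\<theta> p0 p) r)) \<and> \<not> SPO R (restriction (trancl (\<theta> p0 p)) r)"
    using c by blast
qed

end
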